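(* Let $\mathcal X$ be a finite nonempty set of states. Let two imprecise Markov chains on $\mathcal X$ be given by initial upper expectation functionals $\overline E_0,\overline E_0'$ and upper transition operators $\overline T,\overline T'$, and assume both are uniquely convergent, i.e. $\lim_{n\to\infty}\rho(\overline T^n)=0$ and $\lim_{n\to\infty}\rho(\overline T'^n)=0$. Let $r\ge1$ be an integer with $\rho:=\rho(\overline T^r)<1$, and let $n=kr+m$ with integers $k\ge 0$ and $0\le m<r$. Put $\overline E_n=\overline E_0\overline T^n$, $\overline E_n'=\overline E_0'\overline T'^n$, $E_n=d(\overline E_n,\overline E_n')$, $D_n=d(\overline T^n,\overline T'^n)$, $D=D_1=d(\overline T,\overline T')$, and $E_\infty=d(\overline E_\infty,\overline E'_\infty)$, where $\overline E_\infty,\overline E'_\infty$ are the limit distributions of the two chains. Then $$E_n\le E_0\,\rho^k+D\left(r\,\frac{1-\rho^k}{1-\rho}+m\rho^k\right),$$ $$E_\infty\le\frac{Dr}{1-\rho},$$ $$D_n\le D_1\left(r\,\frac{1-\rho^k}{1-\rho}+m\rho^k\right).$$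
   Context: $\mathcal L(\mathcal X)$ is the space of all maps $f:\mathcal X\to\mathbb R$, and $\mathcal L_1=\{f\in\mathcal L(\mathcal X): 0\le f(x)\le 1\ \forall x\in\mathcal X\}$. An expectation functional is a map $E(f)=\sum_{x}p(x)f(x)$ with $p$ a probability mass function on $\mathcal X$. A credal set is a nonempty closed convex set $\mathcal M$ of expectation functionals; its upper expectation functional is $\overline E(f)=\max_{E\in\mathcal M}E(f)$. An upper transition operator is a map $\overline T:\mathcal L(\mathcal X)\to\mathcal L(\mathcal X)$, $\overline Tf(x)=\overline T(f|x)$, where for each $x\in\mathcal X$ the functional $\overline T(\cdot|x)$ is an upper expectation functional. Products denote composition, $\overline T^0$ is the identity, and $(\overline E\,\overline T^n)(f)=\overline E(\overline T^nf)$. Distances: $d(\overline E,\overline E')=\max_{f\in\mathcal L_1}|\overline E(f)-\overline E'(f)|$ for upper expectation functionals, and $d(\overline T,\overline T')=\max_{x\in\mathcal X}d(\overline T(\cdot|x),\overline T'(\cdot|x))$ for upper transition operators. Weak coefficient of ergodicity: $\rho(\overline T)=\max_{x,y\in\mathcal X}d(\overline T(\cdot|x),\overline T(\cdot|y))$. For a uniquely convergent chain the limit distribution is the upper expectation functional $\overline E_\infty(f)=\lim_{n\to\infty}\overline E_n(f)$ (the limit exists and does not depend on $\overline E_0$). Convention: $0^0=1$. *)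

theory Defs
  imports "HOL-Probability.Probability_Mass_Function"
begin

text \<open>
  The finite nonempty state space is a type of class \<open>finite\<close>. Functionals are elements of
  \<open>('a \<Rightarrow> real) \<Rightarrow> real\<close>, and ``closed'' refers to the topology of pointwise convergence. On
  expectation functionals it agrees with the Euclidean topology on mass functions.
\<close>

type_synonym 'a functional = "('a \<Rightarrow> real) \<Rightarrow> real"
type_synonym 'a transition = "('a \<Rightarrow> real) \<Rightarrow> ('a \<Rightarrow> real)"

definition expectation_functional :: "('a::finite) functional \<Rightarrow> bool" where
  "expectation_functional E \<longleftrightarrow> (\<exists>p :: 'a pmf. E = (\<lambda>f. \<Sum>x\<in>UNIV. pmf p x * f x))"

text \<open>Convexity is written out because function types carry no \<open>real_vector\<close> structure.\<close>

definition credal_set :: "('a::finite) functional set \<Rightarrow> bool" where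
  "credal_set M \<longleftrightarrow>
     M \<noteq> {} \<and> (\<forall>E\<in>M. expectation_functional E) \<and> closed M \<and>
     (\<forall>E\<in>M. \<forall>E'\<in>M. \<forall>t\<in>{0..1}. (\<lambda>f. (1 - t) * E f + t * E' f) \<in> M)"

text \<open>The supremum is a maximum for credal sets; see \<open>upper_envelope_attained\<close> below.\<close>

definition upper_envelope :: "('a::finite) functional set \<Rightarrow> 'a functional" where
  "upper_envelope M f = (SUP E\<in>M. E f)"

definition upper_expectation :: "('a::finite) functional \<Rightarrow> bool" where
  "upper_expectation U \<longleftrightarrow> (\<exists>M. credal_set M \<and> U = upper_envelope M)"

definition upper_transition :: "('a::finite) transition \<Rightarrow> bool" where
  "upper_transition T \<longleftrightarrow> (\<forall>x. upper_expectation (\<lambda>f. T f x))"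

definition L1 :: "('a \<Rightarrow> real) set" where
  "L1 = {f. \<forall>x. 0 \<le> f x \<and> f x \<le> 1}"

text \<open>The supremum is a maximum for upper expectations; see \<open>dist_upper_attained\<close> below.\<close>

definition dist_upper :: "('a::finite) functional \<Rightarrow> 'a functional \<Rightarrow> real" where
  "dist_upper U V = (SUP f\<in>L1. \<bar>U f - V f\<bar>)"

definition dist_transition :: "('a::finite) transition \<Rightarrow> 'a transition \<Rightarrow> real" where
  "dist_transition T S = (MAX x\<in>UNIV. dist_upper (\<lambda>f. T f x) (\<lambda>f. S f x))"

definition weak_ergodicity_coeff :: "('a::finite) transition \<Rightarrow> real" where
  "weak_ergodicity_coeff T =
     (MAX (x, y)\<in>UNIV. dist_upper (\<lambda>f. T f x) (\<lambda>f. T f y))"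

definition uniquely_convergent :: "('a::finite) transition \<Rightarrow> bool" where
  "uniquely_convergent T \<longleftrightarrow> (\<lambda>n. weak_ergodicity_coeff (T ^^ n)) \<longlonglongrightarrow> 0"

text \<open>
  For an upper expectation \<open>U\<close> and a uniquely convergent upper transition operator \<open>T\<close>, this
  limit exists by \<open>limit_distribution_tendsto\<close> and does not depend on \<open>U\<close> by
  \<open>limit_distribution_unique\<close> below.
\<close>

definition limit_distribution ::
    "('a::finite) functional \<Rightarrow> 'a transition \<Rightarrow> 'a functional" where
  "limit_distribution U T f = lim (\<lambda>n. (U \<circ> T ^^ n) f)"


lemma compact_expectation_functionals:
  "compact {E :: ('a::finite) functional. expectation_functional E}"
proof -
  define S :: "('a \<Rightarrow> real) set" where
    "S = (PiE UNIV (\<lambda>_. {0..1})) \<inter> {p. (\<Sum>x\<in>UNIV. p x) = 1}"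
  have box: "compact (PiE (UNIV::'a set) (\<lambda>_. {0..1::real}))"
    using compactin_PiE[of "\<lambda>_::'a. euclidean :: real topology" UNIV "\<lambda>_. {0..1}"]
    by (simp add: euclidean_product_topology)
  have "continuous_on UNIV (\<lambda>p :: 'a \<Rightarrow> real. \<Sum>x\<in>UNIV. p x)"
    by (intro continuous_on_sum continuous_on_product_coordinates)
  then have "closed {p :: 'a \<Rightarrow> real. (\<Sum>x\<in>UNIV. p x) = 1}"
    by (intro closed_Collect_eq continuous_on_const)
  then have S: "compact S"
    unfolding S_def by (intro compact_Int_closed box)
  have cont: "continuous_on S (\<lambda>p :: 'a \<Rightarrow> real. \<lambda>f. \<Sum>x\<in>UNIV. p x * f x)"
    by (intro continuous_on_coordinatewise_then_product continuous_on_sum continuous_on_mult_right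
        continuous_on_subset[OF continuous_on_product_coordinates] subset_UNIV)
  have range: "range pmf = S"
  proof -
    have "range pmf = {f :: 'a \<Rightarrow> real. (\<forall>x. 0 \<le> f x) \<and>
            (\<integral>\<^sup>+x. ennreal (f x) \<partial>count_space UNIV) = 1}"
      using type_definition.Rep_range[OF td_pmf_embed_pmf] .
    also have "\<dots> = {f. (\<forall>x. 0 \<le> f x) \<and> (\<Sum>x\<in>UNIV. f x) = 1}"
      by (auto simp: nn_integral_count_space_finite sum_nonneg)
    also have "\<dots> = S"
    proof -
      have "p x \<le> 1" if "\<forall>x. 0 \<le> p x" "sum p UNIV = 1" for p :: "'a \<Rightarrow> real" and x
        using member_le_sum[of x UNIV p] that by auto
      then show ?thesis by (auto simp: S_def PiE_iff)
    qed
    finally show ?thesis .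
  qed
  have "{E :: 'a functional. expectation_functional E} =
      (\<lambda>p f. \<Sum>x\<in>UNIV. p x * f x) ` S"
    unfolding expectation_functional_def range[symmetric] by auto
  then show ?thesis
    using compact_continuous_image[OF cont S] by simp
qed

lemma compact_credal_set:
  assumes "credal_set M"
  shows "compact M"
proof -
  have "{E. expectation_functional E} \<inter> M = M"
    using assms by (auto simp: credal_set_def)
  moreover have "compact ({E. expectation_functional E} \<inter> M)"
    using assms by (intro compact_Int_closed compact_expectation_functionals) (simp add: credal_set_def)
  ultimately show ?thesis by simp
qed

lemma upper_envelope_attained:
  assumes "credal_set M"
  shows "\<exists>E\<in>M. upper_envelope M f = E f \<and> (\<forall>E'\<in>M. E' f \<le> E f)"
proof -
  have "continuous_on M (\<lambda>E. E f)"
    by (rule continuous_on_subset[OF continuous_on_product_coordinates]) simp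
  moreover have "M \<noteq> {}"
    using assms by (simp add: credal_set_def)
  ultimately obtain E where E: "E \<in> M" "\<forall>E'\<in>M. E' f \<le> E f"
    using continuous_attains_sup[OF compact_credal_set[OF assms], of "\<lambda>E. E f"] by metis
  have "upper_envelope M f = E f"
    unfolding upper_envelope_def
  proof (rule cSup_eq_maximum)
    show "E f \<in> (\<lambda>E. E f) ` M"
      using E(1) by (rule imageI)
    show "y \<le> E f" if "y \<in> (\<lambda>E. E f) ` M" for y
      using that E(2) by (elim imageE) simp
  qed
  with E show ?thesis by blast
qed

lemma expectation_functional_diff_le:
  assumes "expectation_functional E" and "\<And>x. f x \<le> g x + c"
  shows "E f \<le> E g + c"
proof -
  from assms(1) obtain p :: "'a pmf" where p: "E = (\<lambda>f. \<Sum>x\<in>UNIV. pmf p x * f x)"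
    by (auto simp: expectation_functional_def)
  have one: "(\<Sum>x\<in>UNIV. pmf p x) = 1"
    by (simp add: sum_pmf_eq_1)
  have "E f \<le> (\<Sum>x\<in>UNIV. pmf p x * (g x + c))"
    unfolding p by (intro sum_mono mult_left_mono assms(2)) simp
  also have "\<dots> = E g + (\<Sum>x\<in>UNIV. pmf p x) * c"
    unfolding p distrib_left sum.distrib sum_distrib_right ..
  finally show ?thesis using one by simp
qed

lemma upper_expectation_diff_le:
  assumes "upper_expectation U" and "\<And>x. f x \<le> g x + c"
  shows "U f \<le> U g + c"
proof -
  obtain M where M: "credal_set M" "U = upper_envelope M"
    using assms(1) by (auto simp: upper_expectation_def)
  obtain E where E: "E \<in> M" "U f = E f"
    using upper_envelope_attained[OF M(1)] M(2) by metis
  obtain E' where E': "U g = E' g" "\<forall>E''\<in>M. E'' g \<le> E' g"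
    using upper_envelope_attained[OF M(1)] M(2) by metis
  have "expectation_functional E"
    using M(1) E(1) by (simp add: credal_set_def)
  then have "E f \<le> E g + c"
    using assms(2) by (rule expectation_functional_diff_le)
  moreover have "E g \<le> E' g"
    using E(1) E'(2) by blast
  ultimately show ?thesis
    unfolding E(2) E'(1) by linarith
qed

lemma upper_expectation_continuous:
  assumes "upper_expectation U"
  shows "continuous_on A U"
proof -
  have lip: "\<bar>U f - U g\<bar> \<le> (\<Sum>x\<in>UNIV. \<bar>f x - g x\<bar>)" for f g
  proof -
    have *: "\<bar>f x - g x\<bar> \<le> (\<Sum>x\<in>UNIV. \<bar>f x - g x\<bar>)" for x
      by (rule member_le_sum) auto
    have "f x \<le> g x + (\<Sum>x\<in>UNIV. \<bar>f x - g x\<bar>)" for x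
      using *[of x] by linarith
    moreover have "g x \<le> f x + (\<Sum>x\<in>UNIV. \<bar>f x - g x\<bar>)" for x
      using *[of x] by linarith
    ultimately have "U f \<le> U g + (\<Sum>x\<in>UNIV. \<bar>f x - g x\<bar>)"
        "U g \<le> U f + (\<Sum>x\<in>UNIV. \<bar>f x - g x\<bar>)"
      by (intro upper_expectation_diff_le[OF assms]; blast)+
    then show ?thesis by linarith
  qed
  show ?thesis
    unfolding continuous_on_def
  proof
    fix g assume "g \<in> A"
    have coord: "((\<lambda>f. f x) \<longlongrightarrow> g x) (at g within A)" for x
      using continuous_on_subset[OF continuous_on_product_coordinates[of x], of A] \<open>g \<in> A\<close>
      by (auto simp: continuous_on_def)
    have "((\<lambda>f. \<Sum>x\<in>UNIV. \<bar>f x - g x\<bar>) \<longlongrightarrow> (\<Sum>x\<in>UNIV. \<bar>g x - g x\<bar>)) (at g within A)"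
      by (intro tendsto_intros coord)
    then have "((\<lambda>f. \<Sum>x\<in>UNIV. \<bar>f x - g x\<bar>) \<longlongrightarrow> 0) (at g within A)"
      by simp
    then have "((\<lambda>f. U f - U g) \<longlongrightarrow> 0) (at g within A)"
      by (rule Lim_null_comparison[rotated]) (simp add: lip)
    then show "(U \<longlongrightarrow> U g) (at g within A)"
      by (simp add: LIM_zero_iff)
  qed
qed

lemma dist_upper_attained:
  assumes "upper_expectation U" and "upper_expectation V"
  shows "\<exists>f\<in>L1. dist_upper U V = \<bar>U f - V f\<bar> \<and> (\<forall>g\<in>L1. \<bar>U g - V g\<bar> \<le> \<bar>U f - V f\<bar>)"
proof -
  have "compact (PiE (UNIV::'a set) (\<lambda>_. {0..1::real}))"
    using compactin_PiE[of "\<lambda>_::'a. euclidean :: real topology" UNIV "\<lambda>_. {0..1}"]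
    by (simp add: euclidean_product_topology)
  moreover have "PiE UNIV (\<lambda>_. {0..1}) = (L1 :: ('a \<Rightarrow> real) set)"
    by (auto simp: L1_def PiE_iff)
  ultimately have "compact (L1 :: ('a \<Rightarrow> real) set)" by simp
  moreover have "(\<lambda>_. 0) \<in> (L1 :: ('a \<Rightarrow> real) set)" by (simp add: L1_def)
  moreover have "continuous_on L1 (\<lambda>f. \<bar>U f - V f\<bar>)"
    by (intro continuous_on_rabs continuous_on_diff upper_expectation_continuous assms)
  ultimately obtain f where f: "f \<in> L1" "\<forall>g\<in>L1. \<bar>U g - V g\<bar> \<le> \<bar>U f - V f\<bar>"
    using continuous_attains_sup[of L1 "\<lambda>f. \<bar>U f - V f\<bar>"] by blast
  then have "dist_upper U V = \<bar>U f - V f\<bar>"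
    unfolding dist_upper_def by (intro cSup_eq_maximum) auto
  with f show ?thesis by blast
qed

lemma upper_expectation_affine:
  assumes "upper_expectation U" and "c \<ge> 0"
  shows "U (\<lambda>x. a + c * f x) = a + c * U f"
proof -
  obtain M where M: "credal_set M" "U = upper_envelope M"
    using assms(1) by (auto simp: upper_expectation_def)
  have aff: "E (\<lambda>x. a + c * f x) = a + c * E f" if "E \<in> M" for E
  proof -
    have "expectation_functional E"
      using M(1) that by (simp add: credal_set_def)
    then obtain p :: "'a pmf" where p: "E = (\<lambda>f. \<Sum>x\<in>UNIV. pmf p x * f x)"
      unfolding expectation_functional_def ..
    have one: "(\<Sum>x\<in>UNIV. pmf p x) = 1"
      by (simp add: sum_pmf_eq_1)
    have "E (\<lambda>x. a + c * f x) = (\<Sum>x\<in>UNIV. pmf p x * a + c * (pmf p x * f x))"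
      unfolding p by (intro sum.cong refl) (simp add: algebra_simps)
    also have "\<dots> = (\<Sum>x\<in>UNIV. pmf p x) * a + c * E f"
      unfolding p sum.distrib sum_distrib_left sum_distrib_right ..
    finally show ?thesis using one by simp
  qed
  obtain E where E: "E \<in> M" "U f = E f" "\<forall>E'\<in>M. E' f \<le> E f"
    using upper_envelope_attained[OF M(1)] M(2) by metis
  have "upper_envelope M (\<lambda>x. a + c * f x) = (SUP E\<in>M. a + c * E f)"
    unfolding upper_envelope_def by (intro SUP_cong refl aff)
  also have "\<dots> = a + c * E f"
  proof (rule cSup_eq_maximum)
    show "a + c * E f \<in> (\<lambda>E. a + c * E f) ` M"
      using E(1) by (rule imageI)
    show "y \<le> a + c * E f" if "y \<in> (\<lambda>E. a + c * E f) ` M" for y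
      using that E(3) assms(2) by (auto intro!: mult_left_mono)
  qed
  finally show ?thesis
    unfolding M(2)[symmetric] E(2) .
qed

lemma upper_expectation_near:
  assumes "upper_expectation U" and "\<And>x. \<bar>f x - v\<bar> \<le> e"
  shows "\<bar>U f - v\<bar> \<le> e"
proof -
  have v: "U (\<lambda>_. v) = v"
    using upper_expectation_affine[OF assms(1), of 0 v f] by simp
  have "f x \<le> v + e" "v \<le> f x + e" for x
    using assms(2)[of x] by linarith+
  then have "U f \<le> U (\<lambda>_. v) + e" "U (\<lambda>_. v) \<le> U f + e"
    by (auto intro: upper_expectation_diff_le[OF assms(1)])
  then show ?thesis
    unfolding v by linarith
qed

lemma upper_transition_power_near:
  assumes "upper_transition T" and "\<And>x. \<bar>f x - v\<bar> \<le> e"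
  shows "\<bar>(T ^^ n) f x - v\<bar> \<le> e"
proof (induction n arbitrary: x)
  case 0
  show ?case using assms(2) by simp
next
  case (Suc n)
  have "upper_expectation (\<lambda>g. T g x)"
    using assms(1) by (simp add: upper_transition_def)
  from upper_expectation_near[OF this Suc.IH] show ?case by simp
qed

lemma upper_transition_power_affine:
  assumes "upper_transition T" and "c \<ge> 0"
  shows "(T ^^ n) (\<lambda>x. a + c * f x) = (\<lambda>x. a + c * (T ^^ n) f x)"
proof (induction n)
  case (Suc n)
  have "T (\<lambda>x. a + c * g x) y = a + c * T g y" for g y
    using upper_expectation_affine[of "\<lambda>g. T g y"] assms by (simp add: upper_transition_def)
  then have "T (\<lambda>x. a + c * g x) = (\<lambda>x. a + c * T g x)" for g
    by (simp add: fun_eq_iff)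
  with Suc show ?case by simp
qed simp

lemma weak_ergodicity_coeff_oscillation:
  assumes "upper_transition T" and "g \<in> L1"
  shows "\<bar>(T ^^ n) g x - (T ^^ n) g y\<bar> \<le> weak_ergodicity_coeff (T ^^ n)"
proof -
  have half: "\<bar>(T ^^ n) h z - 1 / 2\<bar> \<le> 1 / 2" if "h \<in> L1" for h z
  proof (rule upper_transition_power_near[OF assms(1)])
    fix w
    have "0 \<le> h w" "h w \<le> 1"
      using that by (auto simp: L1_def)
    then show "\<bar>h w - 1 / 2\<bar> \<le> 1 / 2"
      by linarith
  qed
  have "\<bar>(T ^^ n) h x - (T ^^ n) h y\<bar> \<le> 1" if "h \<in> L1" for h
    using half[OF that, of x] half[OF that, of y] by linarith
  then have bdd: "bdd_above ((\<lambda>h. \<bar>(T ^^ n) h x - (T ^^ n) h y\<bar>) ` L1)"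
    by (auto simp: bdd_above_def)
  have "\<bar>(T ^^ n) g x - (T ^^ n) g y\<bar>
          \<le> dist_upper (\<lambda>f. (T ^^ n) f x) (\<lambda>f. (T ^^ n) f y)"
    unfolding dist_upper_def using assms(2) bdd by (rule cSUP_upper)
  also have "\<dots> \<le> weak_ergodicity_coeff (T ^^ n)"
    unfolding weak_ergodicity_coeff_def by (rule Max_ge) (auto intro!: image_eqI[of _ _ "(x, y)"])
  finally show ?thesis .
qed

lemma uniquely_convergent_oscillation:
  assumes "upper_transition T" and "uniquely_convergent T" and "e > 0"
  shows "\<exists>N. \<forall>n\<ge>N. \<forall>x y. \<bar>(T ^^ n) f x - (T ^^ n) f y\<bar> \<le> e"
proof -
  define a where "a = Min (range f)"
  define c where "c = Max (range f) - a + 1"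
  have a: "a \<le> f x" and c: "f x \<le> a + c" "c > 0" for x
  proof -
    show 1: "a \<le> f x" by (simp add: a_def)
    have 2: "f x \<le> Max (range f)" by simp
    show "f x \<le> a + c" "c > 0"
      using 1 2 unfolding c_def by linarith+
  qed
  define g where "g x = (f x - a) / c" for x
  have g: "g \<in> L1"
    using a c by (auto simp: L1_def g_def field_simps)
  have f: "f = (\<lambda>x. a + c * g x)"
    using c(2) by (simp add: g_def fun_eq_iff)
  have "e / c > 0" using assms(3) c(2) by simp
  then have "\<forall>\<^sub>F n in sequentially. weak_ergodicity_coeff (T ^^ n) < e / c"
    using assms(2) unfolding uniquely_convergent_def by (rule order_tendstoD(2)[rotated])
  then obtain N where N: "\<And>n. n \<ge> N \<Longrightarrow> weak_ergodicity_coeff (T ^^ n) < e / c"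
    by (auto simp: eventually_sequentially)
  have "\<bar>(T ^^ n) f x - (T ^^ n) f y\<bar> \<le> e" if "n \<ge> N" for n x y
  proof -
    have "(T ^^ n) f z = a + c * (T ^^ n) g z" for z
      using upper_transition_power_affine[OF assms(1), of c n a g] c(2) f by simp
    then have "(T ^^ n) f x - (T ^^ n) f y = c * ((T ^^ n) g x - (T ^^ n) g y)"
      by (simp add: algebra_simps)
    then have "\<bar>(T ^^ n) f x - (T ^^ n) f y\<bar> = c * \<bar>(T ^^ n) g x - (T ^^ n) g y\<bar>"
      using c(2) by (simp add: abs_mult)
    also have "\<dots> \<le> c * (e / c)"
      using weak_ergodicity_coeff_oscillation[OF assms(1) g, of n x y] N[OF that] c(2)
      by (intro mult_left_mono) linarith+
    finally show ?thesis using c(2) by simp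
  qed
  then show ?thesis by blast
qed

lemma uniquely_convergent_near:
  assumes "upper_transition T" and "uniquely_convergent T" and "e > 0"
  shows "\<exists>N v. \<forall>n\<ge>N. \<forall>U. upper_expectation U \<longrightarrow> \<bar>(U \<circ> T ^^ n) f - v\<bar> \<le> e"
proof -
  obtain N where N: "\<And>n x y. n \<ge> N \<Longrightarrow> \<bar>(T ^^ n) f x - (T ^^ n) f y\<bar> \<le> e"
    using uniquely_convergent_oscillation[OF assms] by metis
  define v where "v = (T ^^ N) f undefined"
  have "\<bar>(U \<circ> T ^^ n) f - v\<bar> \<le> e" if "n \<ge> N" "upper_expectation U" for n U
  proof -
    have "(T ^^ n) f = (T ^^ (n - N)) ((T ^^ N) f)"
      using that(1) funpow_add[of "n - N" N T] by (simp add: fun_eq_iff)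
    then have "\<bar>(T ^^ n) f x - v\<bar> \<le> e" for x
      using upper_transition_power_near[OF assms(1), of "(T ^^ N) f" v e] N[of N]
      by (simp add: v_def)
    then show ?thesis
      using upper_expectation_near[OF that(2)] by simp
  qed
  then show ?thesis by blast
qed

lemma limit_distribution_tendsto:
  assumes "upper_expectation U" and "upper_transition T" and "uniquely_convergent T"
  shows "(\<lambda>n. (U \<circ> T ^^ n) f) \<longlonglongrightarrow> limit_distribution U T f"
proof -
  have "Cauchy (\<lambda>n. (U \<circ> T ^^ n) f)"
  proof (rule metric_CauchyI)
    fix e :: real assume "e > 0"
    then obtain N v where N: "\<And>n. n \<ge> N \<Longrightarrow> \<bar>(U \<circ> T ^^ n) f - v\<bar> \<le> e / 3"
      using uniquely_convergent_near[OF assms(2,3), of "e / 3" f] assms(1) by auto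
    have "dist ((U \<circ> T ^^ m) f) ((U \<circ> T ^^ n) f) < e" if "m \<ge> N" "n \<ge> N" for m n
      using N[OF that(1)] N[OF that(2)] \<open>e > 0\<close> unfolding dist_real_def by linarith
    then show "\<exists>N. \<forall>m\<ge>N. \<forall>n\<ge>N. dist ((U \<circ> T ^^ m) f) ((U \<circ> T ^^ n) f) < e"
      by blast
  qed
  then show ?thesis
    unfolding limit_distribution_def
    by (simp add: Cauchy_convergent_iff convergent_LIMSEQ_iff)
qed

lemma limit_distribution_unique:
  assumes "upper_expectation U" and "upper_expectation V"
    and "upper_transition T" and "uniquely_convergent T"
  shows "limit_distribution U T = limit_distribution V T"
proof
  fix f
  have "(\<lambda>n. (U \<circ> T ^^ n) f - (V \<circ> T ^^ n) f) \<longlonglongrightarrow> 0"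
  proof (rule LIMSEQ_I)
    fix e :: real assume "e > 0"
    then obtain N v where
      N: "\<And>n W. n \<ge> N \<Longrightarrow> upper_expectation W \<Longrightarrow> \<bar>(W \<circ> T ^^ n) f - v\<bar> \<le> e / 3"
      using uniquely_convergent_near[OF assms(3,4), of "e / 3" f] by auto
    have "norm ((U \<circ> T ^^ n) f - (V \<circ> T ^^ n) f - 0) < e" if "n \<ge> N" for n
      using N[OF that assms(1)] N[OF that assms(2)] \<open>e > 0\<close>
      unfolding real_norm_def by linarith
    then show "\<exists>N. \<forall>n\<ge>N. norm ((U \<circ> T ^^ n) f - (V \<circ> T ^^ n) f - 0) < e"
      by blast
  qed
  moreover have "(\<lambda>n. (U \<circ> T ^^ n) f - (V \<circ> T ^^ n) f)
      \<longlonglongrightarrow> limit_distribution U T f - limit_distribution V T f"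
    by (intro tendsto_diff limit_distribution_tendsto assms)
  ultimately show "limit_distribution U T f = limit_distribution V T f"
    using LIMSEQ_unique by fastforce
qed

end

theory Submission
  imports Defs
begin

text \<open>
  Write \<open>\<rho>\<close> for the ergodicity coefficient of \<open>T ^^ r\<close> and \<open>D\<close> for the distance of the two
  operators. Everything follows from the effect of \<open>r\<close> time steps on the distance of two
  functionals \<open>U\<close> and \<open>V\<close>, namely
  \<open>dist_upper (U \<circ> T ^^ r) (V \<circ> T' ^^ r) \<le> \<rho> * dist_upper U V + r * D\<close>
  (\<open>dist_upper_comp_power\<close>). By the triangle inequality through \<open>V \<circ> T ^^ r\<close> there are two
  contributions.

  The first is the contraction of \<open>T ^^ r\<close>. For \<open>f \<in> L1\<close> the values of \<open>(T ^^ r) f\<close> differ from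
  each other by at most \<open>\<rho>\<close>, so \<open>(T ^^ r) f = a + \<rho> * g\<close> for a constant \<open>a\<close> and some \<open>g \<in> L1\<close>.
  Since \<open>\<rho> \<ge> 0\<close>, upper expectations commute with this affine map, hence \<open>U\<close> and \<open>V\<close> differ
  at \<open>(T ^^ r) f\<close> by \<open>\<rho> * \<bar>U g - V g\<bar>\<close> (\<open>dist_upper_contraction\<close>).

  The second is the accumulated difference of the operators. Exchanging \<open>T\<close> for \<open>T'\<close> in one of
  the \<open>r\<close> factors costs at most \<open>D\<close>, because \<open>T\<close> and \<open>V\<close> are nonexpansive for the supremum norm
  (\<open>power_diff_le\<close>).

  Iterating the recursion \<open>d \<mapsto> \<rho> * d + r * D\<close> produces the geometric sum of the bound; its initial
  value, after the first \<open>m\<close> steps, is at most \<open>dist_upper E0 E0' + m * D\<close>. The bound on the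
  operators is the case where both initial functionals are evaluation at the same state, and the
  bound on the limit distributions arises by letting \<open>k\<close> tend to infinity along the times
  \<open>n = k * r\<close>.
\<close>

section \<open>Coherent functionals and operators\<close>

text \<open>
  The comparison of two chains at a finite time rests on two properties of upper expectations,
  collected here. They pass directly to compositions such as \<open>U \<circ> T ^^ n\<close>, whereas showing that a
  composition is an upper expectation would mean constructing a credal set for it.
\<close>

definition coherent :: "('a::finite) functional \<Rightarrow> bool" where
  "coherent U \<longleftrightarrow>
     (\<forall>f g c. (\<forall>x. f x \<le> g x + c) \<longrightarrow> U f \<le> U g + c) \<and>
     (\<forall>f a c. 0 \<le> c \<longrightarrow> U (\<lambda>x. a + c * f x) = a + c * U f)"

definition coherent_operator :: "('a::finite) transition \<Rightarrow> bool" where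
  "coherent_operator T \<longleftrightarrow> (\<forall>x. coherent (\<lambda>f. T f x))"

lemma coherent_diff_le:
  assumes "coherent U" and "\<And>x. f x \<le> g x + c"
  shows "U f \<le> U g + c"
  using assms unfolding coherent_def by blast

lemma coherent_affine:
  assumes "coherent U" and "0 \<le> c"
  shows "U (\<lambda>x. a + c * f x) = a + c * U f"
  using assms unfolding coherent_def by blast

lemma coherent_nonexpansive:
  assumes "coherent U" and "\<And>x. \<bar>f x - g x\<bar> \<le> c"
  shows "\<bar>U f - U g\<bar> \<le> c"
proof -
  have "f x \<le> g x + c" "g x \<le> f x + c" for x
    using assms(2)[of x] by linarith+
  then have "U f \<le> U g + c" "U g \<le> U f + c"
    using coherent_diff_le[OF assms(1)] by blast+
  then show ?thesis by linarith
qed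

lemma coherent_L1_bounds:
  assumes "coherent U" and "f \<in> L1"
  shows "0 \<le> U f" and "U f \<le> 1"
proof -
  have const: "U (\<lambda>_. a) = a" for a
    using coherent_affine[OF assms(1), of 0 a f] by simp
  have "U (\<lambda>_. 0) \<le> U f + 0"
    using assms(2) by (intro coherent_diff_le[OF assms(1)]) (simp add: L1_def)
  then show "0 \<le> U f" by (simp add: const)
  have "U f \<le> U (\<lambda>_. 1) + 0"
    using assms(2) by (intro coherent_diff_le[OF assms(1)]) (simp add: L1_def)
  then show "U f \<le> 1" by (simp add: const)
qed

lemma upper_expectation_coherent:
  assumes "upper_expectation U"
  shows "coherent U"
  unfolding coherent_def
  using upper_expectation_diff_le[OF assms] upper_expectation_affine[OF assms] by blast

lemma upper_transition_coherent:
  assumes "upper_transition T"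
  shows "coherent_operator T"
  using assms upper_expectation_coherent
  unfolding upper_transition_def coherent_operator_def by blast

lemma coherent_evaluation: "coherent (\<lambda>f. f x)"
  by (simp add: coherent_def)

lemma coherent_comp:
  assumes "coherent U" and "coherent_operator T"
  shows "coherent (U \<circ> T)"
proof -
  have "U (T f) \<le> U (T g) + c" if "\<forall>x. f x \<le> g x + c" for f g c
    using that assms(2) unfolding coherent_operator_def
    by (intro coherent_diff_le[OF assms(1)] coherent_diff_le[where U = "\<lambda>f. T f x" for x]) auto
  moreover have "U (T (\<lambda>x. a + c * f x)) = a + c * U (T f)" if "0 \<le> c" for f a c
  proof -
    have "T (\<lambda>x. a + c * f x) = (\<lambda>x. a + c * T f x)"
      using assms(2) that coherent_affine unfolding coherent_operator_def by blast
    then show ?thesis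
      using coherent_affine[OF assms(1) that] by simp
  qed
  ultimately show ?thesis by (simp add: coherent_def)
qed

lemma coherent_operator_power:
  assumes "coherent_operator T"
  shows "coherent_operator (T ^^ n)"
proof (induction n)
  case 0
  show ?case by (simp add: coherent_operator_def coherent_evaluation)
next
  case (Suc n)
  have "coherent ((\<lambda>f. (T ^^ n) f x) \<circ> T)" for x
    using Suc assms coherent_comp unfolding coherent_operator_def by blast
  then show ?case
    by (simp add: coherent_operator_def funpow_Suc_right o_def del: funpow.simps)
qed

lemma coherent_operator_L1:
  assumes "coherent_operator T" and "f \<in> L1"
  shows "T f \<in> L1"
  using assms coherent_L1_bounds[where U = "\<lambda>f. T f x" for x]
  by (simp add: L1_def coherent_operator_def)

section \<open>Distances and replacement of one operator by the other\<close>

lemma dist_upper_upper: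
  assumes "coherent U" and "coherent V" and "f \<in> L1"
  shows "\<bar>U f - V f\<bar> \<le> dist_upper U V"
proof -
  have "\<bar>U g - V g\<bar> \<le> 1" if "g \<in> L1" for g
    using coherent_L1_bounds[OF assms(1) that] coherent_L1_bounds[OF assms(2) that] by linarith
  then have "bdd_above ((\<lambda>g. \<bar>U g - V g\<bar>) ` L1)"
    by (auto simp: bdd_above_def)
  with assms(3) show ?thesis
    unfolding dist_upper_def by (rule cSUP_upper)
qed

lemma dist_upper_least:
  assumes "\<And>f. f \<in> L1 \<Longrightarrow> \<bar>U f - V f\<bar> \<le> c"
  shows "dist_upper U V \<le> c"
proof -
  have "(\<lambda>_. 0) \<in> L1" by (simp add: L1_def)
  then show ?thesis
    unfolding dist_upper_def using assms by (intro cSUP_least) auto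
qed

lemma dist_transition_upper:
  assumes "coherent_operator T" and "coherent_operator S" and "f \<in> L1"
  shows "\<bar>T f x - S f x\<bar> \<le> dist_transition T S"
proof -
  have "\<bar>T f x - S f x\<bar> \<le> dist_upper (\<lambda>f. T f x) (\<lambda>f. S f x)"
    using dist_upper_upper[of "\<lambda>f. T f x" "\<lambda>f. S f x"] assms by (simp add: coherent_operator_def)
  also have "\<dots> \<le> dist_transition T S"
    unfolding dist_transition_def by (rule Max_ge) auto
  finally show ?thesis .
qed

text \<open>
  The telescoping step adds the difference at the outermost factor to the difference of the inner
  powers, which the outermost \<open>T\<close> does not enlarge.
\<close>

lemma power_diff_le:
  assumes "coherent_operator T" and "coherent_operator S" and "f \<in> L1"
  shows "\<bar>(T ^^ n) f x - (S ^^ n) f x\<bar> \<le> real n * dist_transition T S"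
proof (induction n arbitrary: x)
  case (Suc n)
  have "\<bar>T ((T ^^ n) f) x - T ((S ^^ n) f) x\<bar> \<le> real n * dist_transition T S"
    using coherent_nonexpansive[of "\<lambda>g. T g x", OF _ Suc] assms(1)
    by (simp add: coherent_operator_def)
  moreover have "\<bar>T ((S ^^ n) f) x - S ((S ^^ n) f) x\<bar> \<le> dist_transition T S"
    using assms(1,2) coherent_operator_L1[OF coherent_operator_power[OF assms(2)] assms(3)]
    by (rule dist_transition_upper)
  moreover have "real (Suc n) * dist_transition T S
      = real n * dist_transition T S + dist_transition T S"
    by (simp add: algebra_simps)
  ultimately show ?case by simp
qed simp

section \<open>Contraction by the coefficient of ergodicity\<close>

lemma L1_rescale:
  assumes "\<And>x y. \<bar>h x - h y\<bar> \<le> c"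
  shows "\<exists>a. \<exists>g\<in>L1. h = (\<lambda>x::'a::finite. a + c * g x)"
proof -
  have c: "0 \<le> c"
    using assms[of undefined undefined] by simp
  define a where "a = Min (range h)"
  \<comment> \<open>For \<open>c = 0\<close> the function \<open>h\<close> is constant and division by zero gives \<open>g = 0\<close>.\<close>
  define g where "g x = (h x - a) / c" for x
  have "a \<in> range h"
    unfolding a_def by (rule Min_in) auto
  then obtain y where y: "a = h y" by blast
  have *: "0 \<le> h x - a" "h x - a \<le> c" for x
    using assms[of x y] by (simp_all add: a_def y[symmetric])
  have "g \<in> L1"
    using * c by (cases "c = 0") (auto simp: L1_def g_def divide_simps)
  moreover have "h = (\<lambda>x. a + c * g x)"
  proof
    fix x
    show "h x = a + c * g x"
      using *[of x] by (cases "c = 0") (auto simp: g_def)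
  qed
  ultimately show ?thesis by blast
qed

lemma weak_ergodicity_coeff_power_nonneg:
  assumes "upper_transition T"
  shows "0 \<le> weak_ergodicity_coeff (T ^^ r)"
proof -
  have "(\<lambda>_. 0) \<in> L1" by (simp add: L1_def)
  from weak_ergodicity_coeff_oscillation[OF assms this] show ?thesis
    using abs_ge_zero order_trans by blast
qed

text \<open>
  The coefficient of ergodicity bounds the oscillation of \<open>(T ^^ r) f\<close>. Rescaling \<open>(T ^^ r) f\<close>
  into \<open>L1\<close> turns this bound into a Lipschitz constant.
\<close>

lemma dist_upper_contraction:
  assumes "upper_transition T" and "coherent U" and "coherent V" and "f \<in> L1"
  shows "\<bar>U ((T ^^ r) f) - V ((T ^^ r) f)\<bar> \<le> weak_ergodicity_coeff (T ^^ r) * dist_upper U V"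
proof -
  let ?\<rho> = "weak_ergodicity_coeff (T ^^ r)"
  have osc: "\<bar>(T ^^ r) f x - (T ^^ r) f y\<bar> \<le> ?\<rho>" for x y
    using assms(1,4) by (rule weak_ergodicity_coeff_oscillation)
  have \<rho>: "0 \<le> ?\<rho>"
    using assms(1) by (rule weak_ergodicity_coeff_power_nonneg)
  from L1_rescale[of "(T ^^ r) f", OF osc] obtain a g where g: "g \<in> L1" "(T ^^ r) f = (\<lambda>x. a + ?\<rho> * g x)"
    by blast
  have "U ((T ^^ r) f) - V ((T ^^ r) f) = ?\<rho> * (U g - V g)"
    unfolding g(2) coherent_affine[OF assms(2) \<rho>] coherent_affine[OF assms(3) \<rho>]
    by (simp add: algebra_simps)
  then show ?thesis
    using dist_upper_upper[OF assms(2,3) g(1)] \<rho> by (simp add: abs_mult mult_left_mono)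
qed

section \<open>The recursion for the distance and its solution\<close>

lemma dist_upper_comp_power:
  assumes "upper_transition T" and "upper_transition T'" and "coherent U" and "coherent V"
  shows "dist_upper (U \<circ> T ^^ r) (V \<circ> T' ^^ r)
           \<le> weak_ergodicity_coeff (T ^^ r) * dist_upper U V + real r * dist_transition T T'"
proof (rule dist_upper_least)
  fix f :: "'a \<Rightarrow> real" assume f: "f \<in> L1"
  have "\<bar>U ((T ^^ r) f) - V ((T ^^ r) f)\<bar> \<le> weak_ergodicity_coeff (T ^^ r) * dist_upper U V"
    using assms(1,3,4) f by (rule dist_upper_contraction)
  moreover have "\<bar>V ((T ^^ r) f) - V ((T' ^^ r) f)\<bar> \<le> real r * dist_transition T T'"
    using assms(4)
      power_diff_le[OF upper_transition_coherent[OF assms(1)] upper_transition_coherent[OF assms(2)] f]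
    by (rule coherent_nonexpansive)
  ultimately show "\<bar>(U \<circ> T ^^ r) f - (V \<circ> T' ^^ r) f\<bar>
      \<le> weak_ergodicity_coeff (T ^^ r) * dist_upper U V + real r * dist_transition T T'"
    by simp
qed

text \<open>
  The first steps, too few for the contraction to be available, only obey this weaker bound.
\<close>

lemma dist_upper_comp_power_nonexpansive:
  assumes "coherent_operator T" and "coherent_operator T'" and "coherent U" and "coherent V"
  shows "dist_upper (U \<circ> T ^^ m) (V \<circ> T' ^^ m)
           \<le> dist_upper U V + real m * dist_transition T T'"
proof (rule dist_upper_least)
  fix f :: "'a \<Rightarrow> real" assume f: "f \<in> L1"
  have "\<bar>U ((T ^^ m) f) - V ((T ^^ m) f)\<bar> \<le> dist_upper U V"
    using assms(3,4) coherent_operator_L1[OF coherent_operator_power[OF assms(1)] f]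
    by (rule dist_upper_upper)
  moreover have "\<bar>V ((T ^^ m) f) - V ((T' ^^ m) f)\<bar> \<le> real m * dist_transition T T'"
    using assms(4) power_diff_le[OF assms(1,2) f] by (rule coherent_nonexpansive)
  ultimately show "\<bar>(U \<circ> T ^^ m) f - (V \<circ> T' ^^ m) f\<bar>
      \<le> dist_upper U V + real m * dist_transition T T'"
    by simp
qed

text \<open>
  Allowing all coherent functionals, rather than upper expectations, makes the bound applicable to
  evaluation at a state, from which the bound on the operators follows.
\<close>

lemma dist_upper_comp_power_geometric:
  fixes \<rho> D :: real
  assumes T: "upper_transition T" and T': "upper_transition T'"
    and U: "coherent U" and V: "coherent V"
    and \<rho>: "\<rho> = weak_ergodicity_coeff (T ^^ r)" "\<rho> < 1"
    and D: "D = dist_transition T T'"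
  shows "dist_upper (U \<circ> T ^^ (k * r + m)) (V \<circ> T' ^^ (k * r + m))
           \<le> dist_upper U V * \<rho> ^ k
              + D * (real r * ((1 - \<rho> ^ k) / (1 - \<rho>)) + real m * \<rho> ^ k)"
    (is "?d k \<le> ?b k")
proof (induction k)
  case 0
  show ?case
    using dist_upper_comp_power_nonexpansive
      [OF upper_transition_coherent[OF T] upper_transition_coherent[OF T'] U V, of m]
    by (simp add: D mult.commute o_def)
next
  case (Suc k)
  let ?n = "k * r + m"
  have coh: "coherent (U \<circ> T ^^ ?n)" "coherent (V \<circ> T' ^^ ?n)"
    using T T' U V by (simp_all add: coherent_comp coherent_operator_power upper_transition_coherent)
  have split: "W \<circ> S ^^ (Suc k * r + m) = (W \<circ> S ^^ ?n) \<circ> S ^^ r"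
    for W :: "'a functional" and S :: "'a transition"
  proof -
    have "Suc k * r + m = ?n + r" by simp
    then show ?thesis by (simp only: funpow_add o_assoc)
  qed
  have "0 \<le> \<rho>"
    unfolding \<rho>(1) using T by (rule weak_ergodicity_coeff_power_nonneg)
  have "?d (Suc k) \<le> \<rho> * ?d k + real r * D"
    unfolding split \<rho>(1) D using T T' coh by (rule dist_upper_comp_power)
  also have "\<dots> \<le> \<rho> * ?b k + real r * D"
    using Suc.IH \<open>0 \<le> \<rho>\<close> by (intro add_mono mult_left_mono) auto
  also have "\<dots> = ?b (Suc k)"
    using \<rho>(2) by (simp add: field_simps)
  finally show ?case .
qed

section \<open>Bounds for chains, limit distributions and operators\<close>

theorem corollary2:
  fixes E0 E0' :: "('a::finite) functional"
    and T T' :: "'a transition"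
    and r n k m :: nat
    and \<rho> D :: real
  assumes "upper_expectation E0" and "upper_expectation E0'"
    and "upper_transition T" and "upper_transition T'"
    and "uniquely_convergent T" and "uniquely_convergent T'"
    and "r \<ge> 1"
    and "\<rho> = weak_ergodicity_coeff (T ^^ r)" and "\<rho> < 1"
    and "n = k * r + m" and "m < r"
    and "D = dist_transition T T'"
  shows "dist_upper (E0 \<circ> T ^^ n) (E0' \<circ> T' ^^ n)
           \<le> dist_upper E0 E0' * \<rho> ^ k
              + D * (real r * ((1 - \<rho> ^ k) / (1 - \<rho>)) + real m * \<rho> ^ k)
       \<and> dist_upper (limit_distribution E0 T) (limit_distribution E0' T')
           \<le> D * real r / (1 - \<rho>)
       \<and> dist_transition (T ^^ n) (T' ^^ n)
           \<le> D * (real r * ((1 - \<rho> ^ k) / (1 - \<rho>)) + real m * \<rho> ^ k)"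
proof (intro conjI)
  let ?b = "\<lambda>k m. D * (real r * ((1 - \<rho> ^ k) / (1 - \<rho>)) + real m * \<rho> ^ k)"
  have main: "dist_upper (U \<circ> T ^^ (j * r + i)) (V \<circ> T' ^^ (j * r + i))
      \<le> dist_upper U V * \<rho> ^ j + ?b j i"
    if "coherent U" "coherent V" for U V i j
    using assms(3,4) that assms(8,9,12) by (rule dist_upper_comp_power_geometric)
  have E: "coherent E0" "coherent E0'"
    using assms(1,2) by (simp_all add: upper_expectation_coherent)
  have Tn: "coherent_operator (T ^^ i)" "coherent_operator (T' ^^ i)" for i
    using assms(3,4) by (simp_all add: coherent_operator_power upper_transition_coherent)
  have \<rho>: "0 \<le> \<rho>"
    unfolding assms(8) using assms(3) by (rule weak_ergodicity_coeff_power_nonneg)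
  show "dist_upper (E0 \<circ> T ^^ n) (E0' \<circ> T' ^^ n) \<le> dist_upper E0 E0' * \<rho> ^ k + ?b k m"
    unfolding assms(10) using E by (rule main)
  show "dist_transition (T ^^ n) (T' ^^ n) \<le> ?b k m"
  proof -
    have "dist_upper (\<lambda>f. (T ^^ n) f x) (\<lambda>f. (T' ^^ n) f x) \<le> ?b k m" for x
    proof -
      have "dist_upper (\<lambda>f. f x) (\<lambda>f. f x) \<le> 0"
        by (rule dist_upper_least) simp
      with \<rho> have "dist_upper (\<lambda>f. f x) (\<lambda>f. f x) * \<rho> ^ k \<le> 0"
        by (simp add: mult_nonpos_nonneg)
      with main[of "\<lambda>f. f x" "\<lambda>f. f x" k m] show ?thesis
        by (simp add: assms(10) o_def coherent_evaluation)
    qed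
    then show ?thesis
      unfolding dist_transition_def by (subst Max_le_iff) auto
  qed
  show "dist_upper (limit_distribution E0 T) (limit_distribution E0' T') \<le> D * real r / (1 - \<rho>)"
  proof (rule dist_upper_least)
    fix f :: "'a \<Rightarrow> real" assume f: "f \<in> L1"
    have sub: "strict_mono (\<lambda>j. j * r)"
      using assms(7) by (intro strict_monoI) simp
    have "(\<lambda>j. (E0 \<circ> T ^^ (j * r)) f) \<longlonglongrightarrow> limit_distribution E0 T f"
      using LIMSEQ_subseq_LIMSEQ[OF limit_distribution_tendsto[OF assms(1,3,5)] sub]
      by (simp add: o_def)
    moreover have "(\<lambda>j. (E0' \<circ> T' ^^ (j * r)) f) \<longlonglongrightarrow> limit_distribution E0' T' f"
      using LIMSEQ_subseq_LIMSEQ[OF limit_distribution_tendsto[OF assms(2,4,6)] sub]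
      by (simp add: o_def)
    ultimately have lhs: "(\<lambda>j. \<bar>(E0 \<circ> T ^^ (j * r)) f - (E0' \<circ> T' ^^ (j * r)) f\<bar>)
        \<longlonglongrightarrow> \<bar>limit_distribution E0 T f - limit_distribution E0' T' f\<bar>"
      by (intro tendsto_intros)
    have "(\<lambda>j. \<rho> ^ j) \<longlonglongrightarrow> 0"
      using \<rho> assms(9) by (simp add: LIMSEQ_realpow_zero)
    then have "(\<lambda>j. dist_upper E0 E0' * \<rho> ^ j + ?b j 0)
        \<longlonglongrightarrow> dist_upper E0 E0' * 0 + D * (real r * ((1 - 0) / (1 - \<rho>)) + real 0 * 0)"
      using \<rho> assms(9) by (intro tendsto_intros) auto
    then have rhs: "(\<lambda>j. dist_upper E0 E0' * \<rho> ^ j + ?b j 0) \<longlonglongrightarrow> D * real r / (1 - \<rho>)"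
      by simp
    have "\<bar>(E0 \<circ> T ^^ (j * r)) f - (E0' \<circ> T' ^^ (j * r)) f\<bar>
        \<le> dist_upper E0 E0' * \<rho> ^ j + ?b j 0" for j
    proof -
      have "\<bar>(E0 \<circ> T ^^ (j * r)) f - (E0' \<circ> T' ^^ (j * r)) f\<bar>
          \<le> dist_upper (E0 \<circ> T ^^ (j * r)) (E0' \<circ> T' ^^ (j * r))"
        using E Tn f by (intro dist_upper_upper coherent_comp)
      also have "\<dots> \<le> dist_upper E0 E0' * \<rho> ^ j + ?b j 0"
        using main[OF E, of j 0] by simp
      finally show ?thesis .
    qed
    then show "\<bar>limit_distribution E0 T f - limit_distribution E0' T' f\<bar> \<le> D * real r / (1 - \<rho>)"
      by (intro LIMSEQ_le[OF lhs rhs]) blast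
  qed
qed

end
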